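(* Let $\mathbb{F}$ be a field, let $M\in \mathbb{F}^{n\times n}$ be a totally regular matrix and let $\mathbf{x}=(x_1,\dots,x_n)^T$ be a vector of distinct variables. Then any multi-output formula computing $M\mathbf{x}$ has size $\Omega(n^2/\log n)$.
   Context: An arithmetic circuit over $\mathbb{F}$ is a directed acyclic graph whose in-degree-0 vertices (input gates) are labelled by variables or field constants and whose other vertices are labelled $+$ or $\times$ with fan-in two; wires may be labelled by field elements, which scale the polynomial carried along them. Each gate computes a polynomial in the natural way; size is the number of gates. A multi-output formula is an arithmetic circuit whose underlying undirected graph has no cycles (gates may have fan-out greater than one, as long as no undirected cycle arises); it computes polynomials $f_1,\dots,f_t$ if there are $t$ gates in it computing $f_1,\dots,f_t$ respectively. A matrix is totally regular if every square submatrix of it is non-singular. *)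

theory Defs
  imports
    Complex_Main
    "HOL-Algebra.Indexed_Polynomials"
    "HOL-Combinatorics.Permutations"
    "Jordan_Normal_Form.DL_Submatrix"
    "Graph_Theory.Digraph"
begin

section \<open>Multivariate polynomials over a field given by its carrier\<close>

text \<open>The field is a record rather than a type, so that a statement can place a quantifier over
  fields inside the scope of an absolute constant. Polynomials are those of
  \<^theory>\<open>HOL-Algebra.Indexed_Polynomials\<close>: functions from monomials (multisets of variables) to
  coefficients. That theory only provides multiplication by a variable; the general product
  is the convolution over all factorisations of a monomial.\<close>

definition (in ring) indexed_mult ::
    "('v multiset \<Rightarrow> 'a) \<Rightarrow> ('v multiset \<Rightarrow> 'a) \<Rightarrow> ('v multiset \<Rightarrow> 'a)"
  where "indexed_mult P Q = (\<lambda>m. \<Oplus>a\<in>{a. a \<subseteq># m}. P a \<otimes> Q (m - a))"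

definition (in ring) indexed_smult :: "'a \<Rightarrow> ('v multiset \<Rightarrow> 'a) \<Rightarrow> ('v multiset \<Rightarrow> 'a)"
  where "indexed_smult c P = (\<lambda>m. c \<otimes> P m)"

lemma finite_submultisets: "finite {a. a \<subseteq># (m :: 'v multiset)}"
proof (induction m)
  case empty
  then show ?case by simp
next
  case (add x m)
  have "{a. a \<subseteq># add_mset x m} \<subseteq> {a. a \<subseteq># m} \<union> add_mset x ` {a. a \<subseteq># m}"
  proof
    fix a assume a: "a \<in> {a. a \<subseteq># add_mset x m}"
    show "a \<in> {a. a \<subseteq># m} \<union> add_mset x ` {a. a \<subseteq># m}"
    proof (cases "x \<in># a")
      case True
      then obtain b where "a = add_mset x b" by (meson multi_member_split)
      with a show ?thesis by simp
    next
      case False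
      with a have "a \<subseteq># m"
        by (simp add: subset_mset.diff_add subseteq_mset_def)
           (metis count_greater_zero_iff le0 not_gr_zero)
      then show ?thesis by simp
    qed
  qed
  with add.IH show ?case by (meson finite_UnI finite_imageI finite_subset)
qed

lemma (in ring) indexed_mult_const:
  assumes "carrier_coeff P" "c \<in> carrier R"
  shows "indexed_mult (indexed_const c) P = indexed_smult c P"
proof
  fix m
  have P: "P k \<in> carrier R" for k
    using assms(1) by (rule carrier_coeffE)
  have "indexed_mult (indexed_const c) P m
      = (\<Oplus>a\<in>{a. a \<subseteq># m}. if {#} = a then c \<otimes> P (m - a) else \<zero>)"
    unfolding indexed_mult_def indexed_const_def
    using assms(2) P by (intro add.finprod_cong') auto
  also have "\<dots> = c \<otimes> P m"
    using assms(2) P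
    by (subst add.finprod_singleton[OF _ finite_submultisets]) auto
  finally show "indexed_mult (indexed_const c) P m = indexed_smult c P m"
    by (simp add: indexed_smult_def)
qed

text \<open>Agreement with the library's multiplication by a variable.\<close>

lemma (in ring) indexed_mult_var:
  assumes "carrier_coeff P"
  shows "indexed_mult (indexed_var i) P = indexed_pmult P i"
proof
  fix m
  have P: "P k \<in> carrier R" for k
    using assms by (rule carrier_coeffE)
  have var: "indexed_var i a = (if a = {#i#} then \<one> else \<zero>)" for a
    unfolding indexed_var_def indexed_pmult_def indexed_const_def
    by (auto dest: multi_member_split)
  have eq: "indexed_mult (indexed_var i) P m
      = (\<Oplus>a\<in>{a. a \<subseteq># m}. if {#i#} = a then P (m - a) else \<zero>)"
    unfolding indexed_mult_def var using P by (intro add.finprod_cong') auto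
  show "indexed_mult (indexed_var i) P m = indexed_pmult P i m"
  proof (cases "i \<in># m")
    case True
    then show ?thesis unfolding eq indexed_pmult_def
      using P by (subst add.finprod_singleton[OF _ finite_submultisets]) auto
  next
    case False
    then have "(\<Oplus>a\<in>{a. a \<subseteq># m}. if {#i#} = a then P (m - a) else \<zero>)
        = (\<Oplus>a\<in>{a. a \<subseteq># m}. \<zero>)"
      using P by (intro add.finprod_cong') auto
    with False show ?thesis unfolding eq indexed_pmult_def by simp
  qed
qed


section \<open>Totally regular matrices\<close>

definition (in ring) mat_det :: "'a mat \<Rightarrow> 'a"
  where "mat_det A =
    (\<Oplus>p\<in>{p. p permutes {0..<dim_row A}}.
       (if evenperm p then \<one> else \<ominus> \<one>) \<otimes> (\<Otimes>i\<in>{0..<dim_row A}. A $$ (i, p i)))"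

definition (in ring) nonsingular :: "'a mat \<Rightarrow> bool"
  where "nonsingular A \<longleftrightarrow> dim_row A = dim_col A \<and> mat_det A \<noteq> \<zero>"

definition (in ring) totally_regular :: "'a mat \<Rightarrow> bool"
  where "totally_regular A \<longleftrightarrow>
    (\<forall>I J. I \<subseteq> {0..<dim_row A} \<and> J \<subseteq> {0..<dim_col A} \<and> card I = card J \<and> I \<noteq> {}
       \<longrightarrow> nonsingular (submatrix A I J))"

text \<open>The entry with index \<open>i\<close> of the vector of linear forms \<open>A (x\<^sub>0, x\<^sub>1, \<dots>)\<^sup>T\<close>; the sum is
  taken coefficientwise.\<close>

definition (in ring) mat_vars :: "'a mat \<Rightarrow> (nat \<Rightarrow> 'v) \<Rightarrow> nat \<Rightarrow> ('v multiset \<Rightarrow> 'a)"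
  where "mat_vars A x i =
    (\<lambda>m. \<Oplus>j\<in>{0..<dim_col A}. indexed_smult (A $$ (i, j)) (indexed_var (x j)) m)"


section \<open>Arithmetic circuits and multi-output formulas\<close>

datatype ('a, 'v) gate_label = Var_Gate 'v | Const_Gate 'a | Plus_Gate | Times_Gate

text \<open>The graph is a multigraph: both inputs of a gate may come from the same gate along two
  different wires. An unlabelled wire is one with scaling factor \<open>\<one>\<close>.\<close>

record ('a, 'v, 'g, 'w) circuit =
  graph :: "('g, 'w) pre_digraph"
  label :: "'g \<Rightarrow> ('a, 'v) gate_label"
  factor :: "'w \<Rightarrow> 'a"

definition (in ring) arith_circuit :: "('a, 'v, 'g, 'w) circuit \<Rightarrow> bool"
  where "arith_circuit C \<longleftrightarrow>
    fin_digraph (graph C) \<and>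
    acyclic (arcs_ends (graph C)) \<and>
    (\<forall>v\<in>verts (graph C).
       case label C v of
         Var_Gate x \<Rightarrow> in_degree (graph C) v = 0
       | Const_Gate c \<Rightarrow> in_degree (graph C) v = 0 \<and> c \<in> carrier R
       | Plus_Gate \<Rightarrow> in_degree (graph C) v = 2
       | Times_Gate \<Rightarrow> in_degree (graph C) v = 2) \<and>
    (\<forall>e\<in>arcs (graph C). factor C e \<in> carrier R)"

definition circuit_size :: "('a, 'v, 'g, 'w) circuit \<Rightarrow> nat"
  where "circuit_size C = card (verts (graph C))"

text \<open>\<open>gate_computes C v P\<close>: the gate \<open>v\<close> of \<open>C\<close> computes the polynomial \<open>P\<close>.\<close>

inductive (in ring) gate_computes ::
    "('a, 'v, 'g, 'w) circuit \<Rightarrow> 'g \<Rightarrow> ('v multiset \<Rightarrow> 'a) \<Rightarrow> bool"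
  for C :: "('a, 'v, 'g, 'w) circuit"
  where
    var: "\<lbrakk>v \<in> verts (graph C); label C v = Var_Gate x\<rbrakk>
      \<Longrightarrow> gate_computes C v (indexed_var x)"
  | const: "\<lbrakk>v \<in> verts (graph C); label C v = Const_Gate c\<rbrakk>
      \<Longrightarrow> gate_computes C v (indexed_const c)"
  | plus: "\<lbrakk>v \<in> verts (graph C); label C v = Plus_Gate;
        in_arcs (graph C) v = {d, e}; d \<noteq> e;
        gate_computes C (tail (graph C) d) P; gate_computes C (tail (graph C) e) Q\<rbrakk>
      \<Longrightarrow> gate_computes C v
            (indexed_padd (indexed_smult (factor C d) P) (indexed_smult (factor C e) Q))"
  | times: "\<lbrakk>v \<in> verts (graph C); label C v = Times_Gate;
        in_arcs (graph C) v = {d, e}; d \<noteq> e;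
        gate_computes C (tail (graph C) d) P; gate_computes C (tail (graph C) e) Q\<rbrakk>
      \<Longrightarrow> gate_computes C v
            (indexed_mult (indexed_smult (factor C d) P) (indexed_smult (factor C e) Q))"

text \<open>A cycle of the underlying undirected multigraph: the \<open>i\<close>-th wire of \<open>es\<close> joins the \<open>i\<close>-th
  vertex of \<open>vs\<close> with its cyclic successor. Two parallel wires form a cycle of length 2.\<close>

definition undirected_cycle :: "('g, 'w) pre_digraph \<Rightarrow> 'g list \<Rightarrow> 'w list \<Rightarrow> bool"
  where "undirected_cycle G vs es \<longleftrightarrow>
    es \<noteq> [] \<and> length vs = length es \<and> distinct vs \<and> distinct es \<and> set es \<subseteq> arcs G \<and>
    (\<forall>i<length es.
       {tail G (es ! i), head G (es ! i)} = {vs ! i, vs ! (Suc i mod length vs)})"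

definition (in ring) multi_output_formula :: "('a, 'v, 'g, 'w) circuit \<Rightarrow> bool"
  where "multi_output_formula C \<longleftrightarrow>
    arith_circuit C \<and> (\<nexists>vs es. undirected_cycle (graph C) vs es)"

definition (in ring) computes_family ::
    "('a, 'v, 'g, 'w) circuit \<Rightarrow> nat \<Rightarrow> (nat \<Rightarrow> 'v multiset \<Rightarrow> 'a) \<Rightarrow> bool"
  where "computes_family C t f \<longleftrightarrow> (\<forall>i<t. \<exists>v\<in>verts (graph C). gate_computes C v (f i))"

end

theory Submission
  imports Defs
begin

text \<open>Fix two variables \<open>p\<close>, \<open>q\<close> and look only at the coefficients of \<open>p\<close> and \<open>q\<close> in the linear
  part of each computed polynomial. At every gate, including products, this pair of coefficients is
  a linear combination of the pairs at the two inputs. Call a gate active if its pair is nonzero. A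
  gate with a single active input only rescales the pair, so up to scaling every pair occurs at a
  variable gate for \<open>p\<close> or \<open>q\<close>, or at a gate with two active inputs. An undirected graph without
  cycles has at most as many edges as vertices, hence there are at most as many gates of the second
  kind as of the first. Since all \<open>2 \<times> 2\<close> minors are nonzero, the \<open>n\<close> outputs have pairwise
  non-proportional pairs, so \<open>p\<close> and \<open>q\<close> together label at least \<open>n / 2\<close> gates. Therefore all
  variables but at most one label at least \<open>n / 4\<close> gates each, which even gives
  a lower bound of order \<open>n\<^sup>2\<close>.\<close>

section \<open>Graphs without undirected cycles\<close>

definition undirected_path :: "('g, 'w) pre_digraph \<Rightarrow> 'g list \<Rightarrow> 'w list \<Rightarrow> bool"
  where "undirected_path G vs es \<longleftrightarrow>
    length vs = Suc (length es) \<and> distinct vs \<and> set es \<subseteq> arcs G \<and>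
    (\<forall>i<length es. {tail G (es ! i), head G (es ! i)} = {vs ! i, vs ! Suc i})"

text \<open>A wire occurring at positions \<open>i < k\<close> would have \<open>vs ! i\<close>
  among the later vertices \<open>vs ! k\<close>, \<open>vs ! Suc k\<close>, against distinctness of
  the vertices.\<close>

lemma undirected_path_distinct_arcs:
  assumes "undirected_path G vs es"
  shows "distinct es"
proof -
  have "es ! i \<noteq> es ! k" if "i < k" "k < length es" for i k
  proof
    assume "es ! i = es ! k"
    with assms that have "vs ! i \<in> {vs ! k, vs ! Suc k}"
      unfolding undirected_path_def by (metis insertI1 order_less_trans)
    moreover have "distinct vs" "Suc k < length vs"
      using assms that unfolding undirected_path_def by auto
    ultimately show False
      using that by (auto simp: nth_eq_iff_index_eq)
  qed
  then show ?thesis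
    unfolding distinct_conv_nth by (metis linorder_neqE_nat)
qed

text \<open>The wire \<open>e\<close> leads from the front of the path back to its
  \<open>j\<close>-th vertex. Of the wires on the path only \<open>es ! 0\<close> touches
  \<open>vs ! 0\<close>, so \<open>ne\<close> suffices to make \<open>e\<close> new. For
  \<open>j = 0\<close> the cycle is a loop, for \<open>j = 1\<close> a pair of parallel
  wires.\<close>

lemma undirected_path_closing_cycle:
  assumes path: "undirected_path G vs es"
    and e: "e \<in> arcs G" "{tail G e, head G e} = {vs ! 0, vs ! j}" "j < length vs"
    and ne: "es \<noteq> [] \<Longrightarrow> e \<noteq> es ! 0"
  shows "undirected_cycle G (take (Suc j) vs) (take j es @ [e])"
proof -
  have len: "length vs = Suc (length es)" and dv: "distinct vs" and sub: "set es \<subseteq> arcs G"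
    and ends: "\<And>i. i < length es \<Longrightarrow> {tail G (es ! i), head G (es ! i)} = {vs ! i, vs ! Suc i}"
    using path unfolding undirected_path_def by auto
  have "e \<noteq> es ! i" if i: "i < j" for i
  proof
    assume eq: "e = es ! i"
    have il: "i < length es" using i e(3) len by simp
    have "i \<noteq> 0" using ne eq il by (metis length_0_conv not_less0)
    moreover have "vs ! 0 \<in> {tail G e, head G e}"
      unfolding e(2) by simp
    then have "vs ! 0 \<in> {vs ! i, vs ! Suc i}"
      unfolding eq ends[OF il] .
    ultimately show False
      using dv il len by (auto simp: nth_eq_iff_index_eq)
  qed
  then have "e \<notin> set (take j es)"
    by (auto simp: in_set_conv_nth)
  then have "distinct (take j es @ [e])"
    using undirected_path_distinct_arcs[OF path] by simp
  moreover have "set (take j es @ [e]) \<subseteq> arcs G"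
    using sub e(1) by (auto dest: in_set_takeD)
  moreover have "{tail G ((take j es @ [e]) ! i), head G ((take j es @ [e]) ! i)}
      = {take (Suc j) vs ! i, take (Suc j) vs ! (Suc i mod length (take (Suc j) vs))}"
    if i: "i < length (take j es @ [e])" for i
  proof (cases "i < j")
    case True
    then have "i < length es" "length (take (Suc j) vs) = Suc j" using e(3) len by simp_all
    with True show ?thesis using ends[of i] e(3) len
      by (simp add: nth_append)
  next
    \<comment> \<open>The last wire is \<open>e\<close> itself, and the cyclic successor of position
      \<open>j\<close> is \<open>Suc j mod Suc j = 0\<close>.\<close>
    case False
    then have "i = j" using i e(3) len by simp
    moreover have "length (take (Suc j) vs) = Suc j" "length (take j es) = j"
      using e(3) len by simp_all
    ultimately show ?thesis using e(2) by (simp add: nth_append insert_commute)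
  qed
  ultimately show ?thesis
    using e(3) len dv unfolding undirected_cycle_def by simp
qed

text \<open>Without a cycle, every path can be prolonged at its front: the front vertex has a
  further wire, and its other end cannot lie on the path. So paths in the finite set
  \<open>V\<close> would be arbitrarily long.\<close>

lemma min_degree_two_undirected_cycle:
  assumes V: "finite V" "V \<noteq> {}" and A: "finite A" "A \<subseteq> arcs G"
    and inc: "\<And>e. e \<in> A \<Longrightarrow> tail G e \<in> V \<and> head G e \<in> V"
    and deg: "\<And>v. v \<in> V \<Longrightarrow> 2 \<le> card {e \<in> A. v \<in> {tail G e, head G e}}"
  shows "\<exists>vs es. undirected_cycle G vs es"
proof (rule ccontr)
  assume no_cycle: "\<nexists>vs es. undirected_cycle G vs es"
  have "\<exists>vs es. undirected_path G vs es \<and> set vs \<subseteq> V \<and> length es = n" for n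
  proof (induction n)
    case 0
    obtain v where "v \<in> V" using V(2) by blast
    then show ?case
      by (intro exI[of _ "[v]"] exI[of _ "[]"]) (simp add: undirected_path_def)
  next
    case (Suc n)
    then obtain vs es where path: "undirected_path G vs es" and vs: "set vs \<subseteq> V" and n: "length es = n"
      by blast
    have len: "length vs = Suc (length es)" using path unfolding undirected_path_def by blast
    then have v0: "vs ! 0 \<in> set vs" by simp
    let ?I = "{e \<in> A. vs ! 0 \<in> {tail G e, head G e}}"
    \<comment> \<open>For \<open>es = []\<close> the value \<open>es ! 0\<close> is unspecified, but
      two incident wires leave a choice whichever wire it is.\<close>
    have "\<not> ?I \<subseteq> {es ! 0}"
    proof
      assume "?I \<subseteq> {es ! 0}"
      then have "card ?I \<le> 1" using card_mono[of "{es ! 0}" ?I] by simp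
      with deg[of "vs ! 0"] v0 vs show False by auto
    qed
    then obtain e where e: "e \<in> A" "vs ! 0 \<in> {tail G e, head G e}" "e \<noteq> es ! 0" by blast
    then obtain w where w: "{tail G e, head G e} = {vs ! 0, w}"
      by (cases "vs ! 0 = tail G e") auto
    have "w \<in> {tail G e, head G e}" unfolding w by simp
    then have "w \<in> V" using inc[OF e(1)] by auto
    have "w \<notin> set vs"
    proof
      assume "w \<in> set vs"
      then obtain j where "j < length vs" "w = vs ! j" by (metis in_set_conv_nth)
      then have "undirected_cycle G (take (Suc j) vs) (take j es @ [e])"
        using e A(2) w by (intro undirected_path_closing_cycle[OF path]) auto
      with no_cycle show False by blast
    qed
    moreover have "{tail G ((e # es) ! i), head G ((e # es) ! i)} = {(w # vs) ! i, (w # vs) ! Suc i}"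
      if "i < length (e # es)" for i
      using that w path unfolding undirected_path_def by (cases i) auto
    ultimately have "undirected_path G (w # vs) (e # es)"
      using path e(1) A(2) unfolding undirected_path_def by auto
    with vs \<open>w \<in> V\<close> n show ?case
      by (intro exI[of _ "w # vs"] exI[of _ "e # es"]) simp
  qed
  then obtain vs es where path: "undirected_path G vs es" "set vs \<subseteq> V" "length es = card V"
    by blast
  \<comment> \<open>A path with \<open>card V\<close> wires has one vertex too many to fit into
    \<open>V\<close>.\<close>
  then have "card (set vs) = Suc (card V)"
    unfolding undirected_path_def by (simp add: distinct_card)
  with path(2) V(1) show False
    using card_mono[of V "set vs"] by simp
qed

text \<open>Some vertex meets at most one wire of \<open>A\<close>, since minimum degree two forces
  a cycle. Deleting it costs one vertex and at most one wire. Stating this for arbitrary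
  \<open>V\<close> and \<open>A\<close> inside one fixed graph keeps the acyclicity hypothesis
  unchanged in the induction.\<close>

lemma card_arcs_le_card_verts_if_no_undirected_cycle:
  assumes "finite V" "finite A" "A \<subseteq> arcs G"
    and "\<And>e. e \<in> A \<Longrightarrow> tail G e \<in> V \<and> head G e \<in> V"
    and "\<nexists>vs es. undirected_cycle G vs es"
  shows "card A \<le> card V"
  using assms
proof (induction "card V" arbitrary: V A)
  case 0
  then show ?case by auto
next
  case (Suc n)
  then have "V \<noteq> {}" by auto
  then obtain v where v: "v \<in> V" "\<not> 2 \<le> card {e \<in> A. v \<in> {tail G e, head G e}}"
    using min_degree_two_undirected_cycle[OF Suc.prems(1) _ Suc.prems(2-4)] Suc.prems(5) by blast
  let ?I = "{e \<in> A. v \<in> {tail G e, head G e}}"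
  have n: "card (V - {v}) = n" using Suc v(1) by simp
  have "card (A - ?I) \<le> card (V - {v})"
    using Suc.prems n by (intro Suc.hyps(1)) auto
  moreover have "card A = card (A - ?I) + card ?I"
    using card_Int_Diff[OF Suc.prems(2), of ?I] by (simp add: Int_absorb1 Collect_conj_eq)
  ultimately show ?case using v(2) n Suc.hyps(2) by linarith
qed


section \<open>Linear parts of computed polynomials\<close>

lemma submultisets_singleton: "{a. a \<subseteq># {#y#}} = {{#}, {#y#}}"
proof -
  have "a \<subseteq># {#y#} \<longleftrightarrow> a = {#} \<or> a = {#y#}" for a
    by (cases a) auto
  then show ?thesis by auto
qed

context cring
begin

text \<open>This is the product rule at the origin: a single variable factors only as a constant
  monomial times itself.\<close>

lemma indexed_mult_singleton:
  assumes "carrier_coeff P" "carrier_coeff Q"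
  shows "indexed_mult P Q {#y#} = P {#} \<otimes> Q {#y#} \<oplus> P {#y#} \<otimes> Q {#}"
  using assms by (simp add: indexed_mult_def submultisets_singleton carrier_coeffE)

lemma indexed_smult_carrier_coeff:
  assumes "c \<in> carrier R" "carrier_coeff P"
  shows "carrier_coeff (indexed_smult c P)"
  using assms by (simp add: indexed_smult_def carrier_coeff_def)

lemma indexed_mult_carrier_coeff:
  assumes "carrier_coeff P" "carrier_coeff Q"
  shows "carrier_coeff (indexed_mult P Q)"
  using assms unfolding indexed_mult_def carrier_coeff_def
  by (auto intro!: finsum_closed)

lemma indexed_var_singleton: "indexed_var y {#z#} = (if y = z then \<one> else \<zero>)"
  by (auto simp: indexed_var_def indexed_pmult_def indexed_const_def)

lemma indexed_const_singleton: "indexed_const c {#z#} = \<zero>"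
  by (simp add: indexed_const_def)

lemma gate_computes_carrier_coeff:
  assumes "arith_circuit C" "gate_computes C v P"
  shows "carrier_coeff P"
  using assms(2)
proof induction
  case (var v x)
  then show ?case by (simp add: indexed_var_def indexed_pmult_def indexed_const_def carrier_coeff_def)
next
  case (const v c)
  then show ?case using assms(1)
    by (force simp: arith_circuit_def indexed_const_def carrier_coeff_def)
next
  case (plus v d e P Q)
  then have "d \<in> arcs (graph C)" "e \<in> arcs (graph C)"
    by (metis in_in_arcs_conv insertCI)+
  with plus assms(1) show ?case
    by (auto simp: arith_circuit_def indexed_padd_def indexed_smult_def carrier_coeff_def)
next
  case (times v d e P Q)
  then have "d \<in> arcs (graph C)" "e \<in> arcs (graph C)"
    by (metis in_in_arcs_conv insertCI)+
  with times assms(1) show ?case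
    by (auto simp: arith_circuit_def intro!: indexed_mult_carrier_coeff indexed_smult_carrier_coeff)
qed

text \<open>Taking complements \<open>a \<mapsto> m - a\<close> is an involution on the submultisets
  of \<open>m\<close>; reindexing the convolution along it swaps the two factors.\<close>

lemma indexed_mult_comm:
  fixes P Q :: "'v multiset \<Rightarrow> 'a"
  assumes "carrier_coeff P" "carrier_coeff Q"
  shows "indexed_mult P Q = indexed_mult Q P"
proof
  fix m :: "'v multiset"
  let ?S = "{a. a \<subseteq># m}" and ?h = "\<lambda>a. m - a"
  have inv: "m - (m - a) = a" if "a \<subseteq># m" for a
    using that by (auto simp: multiset_eq_iff subseteq_mset_def)
  then have inj: "inj_on ?h ?S"
    by (intro inj_on_inverseI[of _ ?h]) simp
  have image: "?h ` ?S = ?S"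
  proof
    show "?S \<subseteq> ?h ` ?S"
    proof
      fix a assume "a \<in> ?S"
      then have "a = ?h (m - a)" "m - a \<in> ?S" using inv by simp_all
      then show "a \<in> ?h ` ?S" by (rule image_eqI)
    qed
  qed auto
  have PQ: "P a \<in> carrier R" "Q a \<in> carrier R" for a
    using assms by (auto intro: carrier_coeffE)
  have "indexed_mult P Q m = (\<Oplus>a\<in>?h ` ?S. P a \<otimes> Q (m - a))"
    unfolding image indexed_mult_def ..
  also have "\<dots> = (\<Oplus>a\<in>?S. P (m - a) \<otimes> Q (m - (m - a)))"
    using PQ inj by (intro finsum_reindex) auto
  also have "\<dots> = (\<Oplus>a\<in>?S. Q a \<otimes> P (m - a))"
    using PQ by (intro finsum_cong') (auto simp: inv intro: m_comm)
  finally show "indexed_mult P Q m = indexed_mult Q P m"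
    unfolding indexed_mult_def .
qed

lemma indexed_padd_comm:
  assumes "carrier_coeff P" "carrier_coeff Q"
  shows "indexed_padd P Q = indexed_padd Q P"
  using assms by (auto simp: indexed_padd_def carrier_coeff_def a_comm)

lemma arith_circuit_factor_closed:
  assumes "arith_circuit C" "d \<in> in_arcs (graph C) v"
  shows "factor C d \<in> carrier R"
  using assms by (simp add: arith_circuit_def)

text \<open>The only ambiguity in the rules is the order in which the two incoming wires
  \<open>{d, e}\<close> are named, and commutativity removes it.\<close>

lemma gate_computes_unique:
  assumes C: "arith_circuit C" and "gate_computes C v P" "gate_computes C v Q"
  shows "P = Q"
  using assms(2,3)
proof (induction arbitrary: Q)
  case (var v x)
  from var.prems var.hyps show ?case by cases auto
next
  case (const v c)
  from const.prems const.hyps show ?case by cases auto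
next
  case (plus v d e P1 P2)
  have cl: "carrier_coeff (indexed_smult (factor C d) P1)" "carrier_coeff (indexed_smult (factor C e) P2)"
    using arith_circuit_factor_closed[OF C, of _ v] gate_computes_carrier_coeff[OF C]
      indexed_smult_carrier_coeff plus.hyps(3,5,6) by blast+
  from plus.prems plus.hyps(2) show ?case
  proof cases
    case (plus d' e' Q1 Q2)
    then have "d' = d \<and> e' = e \<or> d' = e \<and> e' = d"
      using plus.hyps(3) by (auto simp: doubleton_eq_iff)
    then show ?thesis
      using plus plus.IH indexed_padd_comm[OF cl] by auto
  qed auto
next
  case (times v d e P1 P2)
  have cl: "carrier_coeff (indexed_smult (factor C d) P1)" "carrier_coeff (indexed_smult (factor C e) P2)"
    using arith_circuit_factor_closed[OF C, of _ v] gate_computes_carrier_coeff[OF C]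
      indexed_smult_carrier_coeff times.hyps(3,5,6) by blast+
  from times.prems times.hyps(2) show ?case
  proof cases
    case (times d' e' Q1 Q2)
    then have "d' = d \<and> e' = e \<or> d' = e \<and> e' = d"
      using times.hyps(3) by (auto simp: doubleton_eq_iff)
    then show ?thesis
      using times times.IH indexed_mult_comm[OF cl] by auto
  qed auto
qed

text \<open>An induction that treats sums and products alike. At a product the weights
  \<open>\<alpha>\<close> and \<open>\<beta>\<close> contain the constant term of the other input;
  what matters is that they do not depend on \<open>y\<close>, so the coefficients of all variables
  are combined with the same weights.\<close>

lemma gate_computes_linear_induct [consumes 2, case_names var const gate]:
  assumes C: "arith_circuit C" and "gate_computes C v P"
    and var: "\<And>v x. v \<in> verts (graph C) \<Longrightarrow> label C v = Var_Gate x \<Longrightarrow> T v (indexed_var x)"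
    and const: "\<And>v c. v \<in> verts (graph C) \<Longrightarrow> label C v = Const_Gate c \<Longrightarrow> T v (indexed_const c)"
    and gate: "\<And>v d e \<alpha> \<beta> P P1 P2.
      \<lbrakk>v \<in> verts (graph C); in_arcs (graph C) v = {d, e}; d \<noteq> e; gate_computes C v P;
       gate_computes C (tail (graph C) d) P1; gate_computes C (tail (graph C) e) P2;
       T (tail (graph C) d) P1; T (tail (graph C) e) P2; \<alpha> \<in> carrier R; \<beta> \<in> carrier R;
       \<And>y. P {#y#} = \<alpha> \<otimes> P1 {#y#} \<oplus> \<beta> \<otimes> P2 {#y#}\<rbrakk> \<Longrightarrow> T v P"
  shows "T v P"
  using assms(2)
proof induction
  case (plus v d e P1 P2)
  have "factor C d \<in> carrier R" "factor C e \<in> carrier R"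
    using arith_circuit_factor_closed[OF C, of _ v] plus.hyps(3) by blast+
  with plus show ?case
    by (intro gate[of v d e _ P1 P2 "factor C d" "factor C e"] gate_computes.plus)
      (auto simp: indexed_padd_def indexed_smult_def)
next
  case (times v d e P1 P2)
  let ?f = "factor C d" and ?g = "factor C e"
  have fg: "?f \<in> carrier R" "?g \<in> carrier R"
    using arith_circuit_factor_closed[OF C, of _ v] times.hyps(3) by blast+
  have cc: "carrier_coeff P1" "carrier_coeff P2"
    using gate_computes_carrier_coeff[OF C] times.hyps(5,6) by blast+
  then have P: "P1 m \<in> carrier R" "P2 m \<in> carrier R" for m
    by (auto intro: carrier_coeffE)
  have "indexed_mult (indexed_smult ?f P1) (indexed_smult ?g P2) {#y#}
      = (?f \<otimes> (?g \<otimes> P2 {#})) \<otimes> P1 {#y#} \<oplus> (?f \<otimes> (?g \<otimes> P1 {#})) \<otimes> P2 {#y#}" for y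
    using fg P cc
    by (subst indexed_mult_singleton)
      (simp_all add: indexed_smult_carrier_coeff, simp add: indexed_smult_def m_ac a_comm)
  with times fg P show ?case
    by (intro gate[of v d e _ P1 P2 "?f \<otimes> (?g \<otimes> P2 {#})" "?f \<otimes> (?g \<otimes> P1 {#})"]
          gate_computes.times) auto
qed (auto intro: var const)

end


section \<open>Minors of totally regular matrices\<close>

context cring
begin

lemma mat_vars_singleton:
  assumes "inj_on x {0..<dim_col A}" "a < dim_col A" "\<And>j. j < dim_col A \<Longrightarrow> A $$ (i, j) \<in> carrier R"
  shows "mat_vars A x i {#x a#} = A $$ (i, a)"
proof -
  have "mat_vars A x i {#x a#} = (\<Oplus>j\<in>{0..<dim_col A}. if a = j then A $$ (i, j) else \<zero>)"
    unfolding mat_vars_def indexed_smult_def indexed_var_singleton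
    using assms by (intro finsum_cong') (auto simp: inj_on_eq_iff)
  also have "\<dots> = A $$ (i, a)"
    using assms by (intro add.finprod_singleton) auto
  finally show ?thesis .
qed

lemma mat_det_2:
  assumes "dim_row A = 2" "\<And>i j. i < 2 \<Longrightarrow> j < 2 \<Longrightarrow> A $$ (i, j) \<in> carrier R"
  shows "mat_det A = A $$ (0, 0) \<otimes> A $$ (1, 1) \<ominus> A $$ (0, 1) \<otimes> A $$ (1, 0)"
proof -
  let ?t = "Transposition.transpose 0 (1 :: nat)"
  have set: "{0..<2} = {0, 1 :: nat}" by auto
  have perms: "{p. p permutes {0, 1 :: nat}} = {id, ?t}"
    by (auto simp: permutes_doubleton_iff)
  have "?t 0 \<noteq> id 0" by simp
  then have ne: "id \<noteq> ?t" by metis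
  have A: "A $$ (0, 0) \<in> carrier R" "A $$ (0, Suc 0) \<in> carrier R"
    "A $$ (Suc 0, 0) \<in> carrier R" "A $$ (Suc 0, Suc 0) \<in> carrier R"
    using assms(2) by auto
  show ?thesis
    using ne A unfolding mat_det_def assms(1) set perms
    by (simp add: evenperm_swap l_minus minus_eq)
qed

lemma totally_regular_minor_2:
  assumes "A \<in> carrier_mat n n" "elements_mat A \<subseteq> carrier R" "totally_regular A"
    and "i < n" "j < n" "i \<noteq> j" "a < b" "b < n"
  shows "A $$ (i, a) \<otimes> A $$ (j, b) \<noteq> A $$ (i, b) \<otimes> A $$ (j, a)"
proof -
  have A: "A $$ (k, l) \<in> carrier R" if "k < n" "l < n" for k l
    using assms(2) elements_matI[OF assms(1) that refl] by blast
  \<comment> \<open>\<open>submatrix\<close> keeps rows in increasing order, so \<open>i < j\<close>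
    is treated first; exchanging the rows only swaps the two sides of the inequality.\<close>
  have minor: "A $$ (i, a) \<otimes> A $$ (j, b) \<noteq> A $$ (i, b) \<otimes> A $$ (j, a)" if ij: "i < j" "j < n" for i j
  proof -
    let ?B = "submatrix A {i, j} {a, b}"
    \<comment> \<open>The position of an entry in the submatrix is the number of selected indices
      below it, hence 0 or 1.\<close>
    have row: "{k \<in> {i, j}. k < i} = {}" "{k \<in> {i, j}. k < j} = {i}"
      and col: "{k \<in> {a, b}. k < a} = {}" "{k \<in> {a, b}. k < b} = {a}"
      using ij assms(7) by auto
    have B: "?B $$ (0, 0) = A $$ (i, a)" "?B $$ (0, 1) = A $$ (i, b)"
      "?B $$ (1, 0) = A $$ (j, a)" "?B $$ (1, 1) = A $$ (j, b)"
      using submatrix_index_card[of i A a "{i, j}" "{a, b}"] submatrix_index_card[of i A b "{i, j}" "{a, b}"]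
        submatrix_index_card[of j A a "{i, j}" "{a, b}"] submatrix_index_card[of j A b "{i, j}" "{a, b}"]
        assms(1,7,8) ij unfolding row col by auto
    have "{k. k < n \<and> k \<in> {i, j}} = {i, j}" using ij by auto
    then have dim: "dim_row ?B = 2" using assms(1) ij by (simp add: dim_submatrix)
    have "?B $$ (k, l) \<in> carrier R" if "k < 2" "l < 2" for k l
      using that B A ij assms(7,8) by (auto simp: less_2_cases_iff)
    then have det: "mat_det ?B = A $$ (i, a) \<otimes> A $$ (j, b) \<ominus> A $$ (i, b) \<otimes> A $$ (j, a)"
      using mat_det_2[OF dim] B by simp
    have "{i, j} \<subseteq> {0..<dim_row A}" "{a, b} \<subseteq> {0..<dim_col A}" "card {i, j} = card {a, b}" "{i, j} \<noteq> {}"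
      using assms(1,7,8) ij by auto
    then have "nonsingular ?B"
      using assms(3) unfolding totally_regular_def by blast
    then have "mat_det ?B \<noteq> \<zero>" unfolding nonsingular_def by blast
    then show ?thesis
      using det A ij assms(7,8) by auto
  qed
  show ?thesis
  proof (cases "i < j")
    case True
    then show ?thesis using minor assms(5) by blast
  next
    case False
    then have "A $$ (j, a) \<otimes> A $$ (i, b) \<noteq> A $$ (j, b) \<otimes> A $$ (i, a)"
      using minor assms(4,6) by simp
    then show ?thesis
      using assms(4,5,7,8) by (simp add: A m_comm[of "A $$ (j, a)"] m_comm[of "A $$ (j, b)"])
  qed
qed

end


section \<open>Active gates\<close>

context cring
begin

definition active_gates :: "('a, 'v, 'g, 'w) circuit \<Rightarrow> 'v \<Rightarrow> 'v \<Rightarrow> 'g set"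
  where "active_gates C p q = {v \<in> verts (graph C).
    \<exists>P. gate_computes C v P \<and> (P {#p#} \<noteq> \<zero> \<or> P {#q#} \<noteq> \<zero>)}"

definition active_in_arcs :: "('a, 'v, 'g, 'w) circuit \<Rightarrow> 'v \<Rightarrow> 'v \<Rightarrow> 'g \<Rightarrow> 'w set"
  where "active_in_arcs C p q v = {e \<in> in_arcs (graph C) v. tail (graph C) e \<in> active_gates C p q}"

definition merging_gates :: "('a, 'v, 'g, 'w) circuit \<Rightarrow> 'v \<Rightarrow> 'v \<Rightarrow> 'g set"
  where "merging_gates C p q = {v \<in> active_gates C p q. 2 \<le> card (active_in_arcs C p q v)}"

definition var_gates :: "('a, 'v, 'g, 'w) circuit \<Rightarrow> 'v \<Rightarrow> 'g set"
  where "var_gates C p = {v \<in> verts (graph C). label C v = Var_Gate p}"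

lemma gate_computes_active:
  assumes "gate_computes C v P" "P {#p#} \<noteq> \<zero> \<or> P {#q#} \<noteq> \<zero>"
  shows "v \<in> active_gates C p q"
proof -
  have "v \<in> verts (graph C)" using assms(1) by cases auto
  then show ?thesis using assms unfolding active_gates_def by blast
qed

text \<open>A linear combination of zero pairs is zero, so activity must come from an input; at an
  input gate it can only come from the label \<open>p\<close> or \<open>q\<close>.\<close>

lemma active_gate_input:
  assumes C: "arith_circuit C" and v: "v \<in> active_gates C p q"
  shows "v \<in> var_gates C p \<union> var_gates C q \<or> active_in_arcs C p q v \<noteq> {}"
proof -
  obtain P where P: "gate_computes C v P" "P {#p#} \<noteq> \<zero> \<or> P {#q#} \<noteq> \<zero>"
    using v unfolding active_gates_def by blast
  show ?thesis
    using C P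
  proof (induction rule: gate_computes_linear_induct)
    case (gate v d e \<alpha> \<beta> P P1 P2)
    then have "\<not> (P1 {#p#} = \<zero> \<and> P1 {#q#} = \<zero> \<and> P2 {#p#} = \<zero> \<and> P2 {#q#} = \<zero>)" by auto
    then have "tail (graph C) d \<in> active_gates C p q \<or> tail (graph C) e \<in> active_gates C p q"
      using gate_computes_active[OF gate.hyps(5), of p q] gate_computes_active[OF gate.hyps(6), of p q]
      by blast
    then show ?case
      using gate.hyps(2) unfolding active_in_arcs_def by blast
  qed (auto simp: var_gates_def indexed_var_singleton indexed_const_singleton split: if_splits)
qed

text \<open>Count the wires \<open>?A\<close> joining active gates. Each active gate outside
  \<open>?L\<close> receives at least one, each merging gate at least two, and acyclicity allows at
  most \<open>card ?D\<close>. Hence \<open>card (?D - ?L) + card ?B \<le> card ?D \<le> card (?D -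
  ?L) + card ?L\<close>, and the common term cancels.\<close>

lemma card_merging_gates_le:
  assumes "multi_output_formula C"
  shows "card (merging_gates C p q) \<le> card (var_gates C p \<union> var_gates C q)"
proof -
  let ?D = "active_gates C p q" and ?B = "merging_gates C p q" and ?L = "var_gates C p \<union> var_gates C q"
  let ?A = "\<Union>v\<in>?D. active_in_arcs C p q v"
  have C: "arith_circuit C" and forest: "\<nexists>vs es. undirected_cycle (graph C) vs es"
    using assms unfolding multi_output_formula_def by auto
  interpret G: fin_digraph "graph C" using C unfolding arith_circuit_def by blast
  have D: "finite ?D" "?B \<subseteq> ?D" and L: "finite ?L"
    by (auto simp: active_gates_def merging_gates_def var_gates_def)
  have fin: "finite (active_in_arcs C p q v)" for v
    by (auto simp: active_in_arcs_def)
  have "?A \<subseteq> arcs (graph C)" by (auto simp: active_in_arcs_def)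
  moreover have "tail (graph C) e \<in> ?D \<and> head (graph C) e \<in> ?D" if "e \<in> ?A" for e
    using that by (auto simp: active_in_arcs_def)
  ultimately have "card ?A \<le> card ?D"
    using D(1) fin forest by (intro card_arcs_le_card_verts_if_no_undirected_cycle) auto
  moreover have "card ?A = (\<Sum>v\<in>?D. card (active_in_arcs C p q v))"
    using D(1) fin by (intro card_UN_disjoint) (auto simp: active_in_arcs_def)
  moreover have "(\<Sum>v\<in>?D. (if v \<in> ?L then 0 else 1) + (if v \<in> ?B then 1 else 0))
      \<le> (\<Sum>v\<in>?D. card (active_in_arcs C p q v))"
  proof (rule sum_mono)
    fix v assume v: "v \<in> ?D"
    show "(if v \<in> ?L then 0 else 1) + (if v \<in> ?B then 1 else 0) \<le> card (active_in_arcs C p q v)"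
    proof (cases "v \<in> ?B")
      case True
      then show ?thesis by (simp add: merging_gates_def)
    next
      case False
      with active_gate_input[OF C v] fin[of v] show ?thesis
        by (auto simp: Suc_le_eq card_gt_0_iff)
    qed
  qed
  moreover have "(\<Sum>v\<in>?D. (if v \<in> ?L then 0 else 1) + (if v \<in> ?B then 1 else 0 :: nat))
      = card (?D - ?L) + card ?B"
  proof -
    have "(\<Sum>v\<in>?D. if v \<in> ?L then 0 else 1 :: nat) = card (?D - ?L)"
      using D(1) by (auto simp: sum.If_cases intro!: arg_cong[of _ _ card])
    moreover have "(\<Sum>v\<in>?D. if v \<in> ?B then 1 else 0 :: nat) = card ?B"
      using D by (simp add: sum.If_cases Int_absorb1)
    ultimately show ?thesis by (simp only: sum.distrib)
  qed
  moreover have "card ?D \<le> card (?D - ?L) + card ?L"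
    using D(1) L by (metis card_mono card_Un_le finite_UnI Un_Diff_cancel2 Un_upper1 order_trans)
  ultimately show ?thesis by linarith
qed

text \<open>Following the active inputs down from an active gate, the pair of linear coefficients only
  gets scaled until a merging gate or a variable is reached.\<close>

lemma active_gate_scaled_root:
  assumes "arith_circuit C" "gate_computes C v P" "P {#p#} \<noteq> \<zero> \<or> P {#q#} \<noteq> \<zero>"
  shows "\<exists>r \<in> merging_gates C p q \<union> (var_gates C p \<union> var_gates C q). \<exists>c\<in>carrier R. \<exists>Q.
    gate_computes C r Q \<and> P {#p#} = c \<otimes> Q {#p#} \<and> P {#q#} = c \<otimes> Q {#q#}"
    (is "\<exists>r \<in> ?roots. ?scaled P r")
  using assms
proof (induction rule: gate_computes_linear_induct)
  case (var v x)
  then have "v \<in> ?roots"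
    by (auto simp: var_gates_def indexed_var_singleton split: if_splits)
  moreover have "?scaled (indexed_var x) v"
    using var.hyps by (intro bexI[of _ \<one>] exI[of _ "indexed_var x"])
      (auto intro: gate_computes.var simp: indexed_var_singleton)
  ultimately show ?case by blast
next
  case (const v c)
  then show ?case by (simp add: indexed_const_singleton)
next
  case (gate v d e \<alpha> \<beta> P P1 P2)
  have cc: "carrier_coeff P" "carrier_coeff P1" "carrier_coeff P2"
    using gate.hyps assms(1) by (auto intro: gate_computes_carrier_coeff)
  then have cl: "P m \<in> carrier R" "P1 m \<in> carrier R" "P2 m \<in> carrier R" for m
    by (auto intro: carrier_coeffE)
  \<comment> \<open>This covers both cases where one input has zero pair: \<open>S\<close> is the
    polynomial of the other input and \<open>\<gamma>\<close> its weight. The root of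
    \<open>S\<close> serves for \<open>P\<close>, with \<open>\<gamma>\<close> multiplied into the
    scalar.\<close>
  have rescale: ?case
    if eq: "\<And>y. y \<in> {p, q} \<Longrightarrow> P {#y#} = \<gamma> \<otimes> S {#y#}" and \<gamma>: "\<gamma> \<in> carrier R"
      and S: "gate_computes C u S"
      and IH: "S {#p#} \<noteq> \<zero> \<or> S {#q#} \<noteq> \<zero> \<Longrightarrow> \<exists>r \<in> ?roots. ?scaled S r" for \<gamma> S u
  proof -
    have "S {#p#} \<noteq> \<zero> \<or> S {#q#} \<noteq> \<zero>"
      using gate.prems eq \<gamma> by auto
    then obtain r c Q where r: "r \<in> ?roots" "c \<in> carrier R" "gate_computes C r Q"
        "S {#p#} = c \<otimes> Q {#p#}" "S {#q#} = c \<otimes> Q {#q#}"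
      using IH by blast
    have "Q m \<in> carrier R" for m
      using gate_computes_carrier_coeff[OF assms(1) r(3)] by (rule carrier_coeffE)
    then have "P {#p#} = (\<gamma> \<otimes> c) \<otimes> Q {#p#}" "P {#q#} = (\<gamma> \<otimes> c) \<otimes> Q {#q#}"
      using eq r \<gamma> by (auto simp: m_assoc)
    then show ?thesis using r(1-3) \<gamma> by blast
  qed
  consider
      "P2 {#p#} = \<zero>" "P2 {#q#} = \<zero>" | "P1 {#p#} = \<zero>" "P1 {#q#} = \<zero>"
    | "P1 {#p#} \<noteq> \<zero> \<or> P1 {#q#} \<noteq> \<zero>" "P2 {#p#} \<noteq> \<zero> \<or> P2 {#q#} \<noteq> \<zero>"
    by blast
  then show ?case
  proof cases
    case 1
    then show ?thesis
      using gate.hyps gate.IH cl by (intro rescale[of \<alpha> P1 "tail (graph C) d"]) auto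
  next
    case 2
    then show ?thesis
      using gate.hyps gate.IH cl by (intro rescale[of \<beta> P2 "tail (graph C) e"]) auto
  next
    \<comment> \<open>Both inputs are active, so the gate merges and is its own root with scalar
      \<open>\<one>\<close>.\<close>
    case 3
    then have "tail (graph C) d \<in> active_gates C p q" "tail (graph C) e \<in> active_gates C p q"
      using gate_computes_active[OF gate.hyps(5)] gate_computes_active[OF gate.hyps(6)] by simp_all
    then have "active_in_arcs C p q v = {d, e}"
      using gate.hyps(2) unfolding active_in_arcs_def by blast
    then have "v \<in> ?roots"
      using gate.hyps(3) gate_computes_active[OF gate.hyps(4) gate.prems]
      by (simp add: merging_gates_def)
    moreover have "?scaled P v"
      using gate.hyps(4) cl by (intro bexI[of _ \<one>] exI[of _ P]) auto
    ultimately show ?thesis by blast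
  qed
qed

text \<open>Each output is assigned a root of which its pair is a multiple. Outputs sharing a root
  would have proportional pairs, so there are at least \<open>card I\<close> roots, and at most half
  of this bound can be lost to merging gates.\<close>

lemma card_independent_outputs_le:
  assumes C: "multi_output_formula C" and I: "finite I" "2 \<le> card I"
    and f: "\<And>i. i \<in> I \<Longrightarrow> \<exists>v. gate_computes C v (f i)"
    and indep: "\<And>i j. i \<in> I \<Longrightarrow> j \<in> I \<Longrightarrow> i \<noteq> j \<Longrightarrow> f i {#p#} \<otimes> f j {#q#} \<noteq> f i {#q#} \<otimes> f j {#p#}"
  shows "card I \<le> 2 * card (var_gates C p \<union> var_gates C q)"
proof -
  let ?L = "var_gates C p \<union> var_gates C q"
  let ?roots = "merging_gates C p q \<union> ?L"
  let ?root = "\<lambda>i r. r \<in> ?roots \<and> (\<exists>c\<in>carrier R. \<exists>Q.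
    gate_computes C r Q \<and> f i {#p#} = c \<otimes> Q {#p#} \<and> f i {#q#} = c \<otimes> Q {#q#})"
  have arith: "arith_circuit C" using C unfolding multi_output_formula_def by blast
  then interpret G: fin_digraph "graph C" unfolding arith_circuit_def by blast
  have "\<exists>r. ?root i r" if i: "i \<in> I" for i
  proof -
    \<comment> \<open>A second index shows that the pair of \<open>f i\<close> is nonzero: a zero
      pair would make both sides of \<open>indep\<close> vanish. This is where
      \<open>2 \<le> card I\<close> enters.\<close>
    have "\<not> I \<subseteq> {i}"
      using I card_mono[of "{i}" I] by auto
    then obtain j where j: "j \<in> I" "i \<noteq> j" by blast
    obtain v w where v: "gate_computes C v (f i)" and w: "gate_computes C w (f j)"
      using f i j by blast
    have "f j m \<in> carrier R" for m
      using gate_computes_carrier_coeff[OF arith w] by (rule carrier_coeffE)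
    then have "f i {#p#} \<noteq> \<zero> \<or> f i {#q#} \<noteq> \<zero>"
      using indep[OF i j] by auto
    then show ?thesis
      using active_gate_scaled_root[OF arith v] by blast
  qed
  then obtain r where r: "\<And>i. i \<in> I \<Longrightarrow> ?root i (r i)" by metis
  have "inj_on r I"
  proof (rule inj_onI, rule ccontr)
    fix i j assume ij: "i \<in> I" "j \<in> I" "r i = r j" "i \<noteq> j"
    obtain c Q where c: "c \<in> carrier R" "gate_computes C (r i) Q"
        "f i {#p#} = c \<otimes> Q {#p#}" "f i {#q#} = c \<otimes> Q {#q#}"
      using r[OF ij(1)] by blast
    obtain c' Q' where c': "c' \<in> carrier R" "gate_computes C (r i) Q'"
        "f j {#p#} = c' \<otimes> Q' {#p#}" "f j {#q#} = c' \<otimes> Q' {#q#}"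
      using r[OF ij(2)] ij(3) by auto
    \<comment> \<open>Both pairs are thus multiples of the same pair, and their determinant
      vanishes.\<close>
    have "Q' = Q" using gate_computes_unique[OF arith c'(2) c(2)] .
    moreover have "Q m \<in> carrier R" for m
      using gate_computes_carrier_coeff[OF arith c(2)] by (rule carrier_coeffE)
    ultimately have "f i {#p#} \<otimes> f j {#q#} = f i {#q#} \<otimes> f j {#p#}"
      using c(1,3,4) c'(1,3,4) by (simp add: m_ac)
    with indep ij show False by blast
  qed
  moreover have "r ` I \<subseteq> ?roots" using r by blast
  moreover have "finite ?roots"
    by (auto simp: active_gates_def merging_gates_def var_gates_def)
  ultimately have "card I \<le> card ?roots" by (metis card_inj_on_le)
  also have "\<dots> \<le> card (merging_gates C p q) + card ?L" by (rule card_Un_le)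
  also have "\<dots> \<le> 2 * card ?L" using card_merging_gates_le[OF C, of p q] by simp
  finally show ?thesis .
qed

section \<open>The quadratic lower bound, by summing over all variables\<close>

lemma circuit_size_ge_quadratic:
  assumes M: "M \<in> carrier_mat n n" "elements_mat M \<subseteq> carrier R" "totally_regular M"
    and x: "inj_on x {0..<n}" and C: "multi_output_formula C"
    and comp: "computes_family C n (mat_vars M x)" and n: "2 \<le> n"
  shows "n * (n - 1) \<le> 4 * circuit_size C"
proof -
  let ?l = "\<lambda>a. card (var_gates C (x a))"
  have "fin_digraph (graph C)"
    using C unfolding multi_output_formula_def arith_circuit_def by blast
  then interpret G: fin_digraph "graph C" .
  have fin: "finite (var_gates C y)" for y by (auto simp: var_gates_def)
  have coeff: "mat_vars M x i {#x a#} = M $$ (i, a)" if "i < n" "a < n" for i a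
  proof (rule mat_vars_singleton)
    show "M $$ (i, j) \<in> carrier R" if "j < dim_col M" for j
      using M(1,2) \<open>i < n\<close> that elements_matI[OF M(1) _ _ refl, of i j] by auto
  qed (use that M(1) x in auto)
  have pair: "n \<le> 2 * (?l a + ?l b)" if ab: "a < b" "b < n" for a b
  proof -
    have "card {0..<n} \<le> 2 * card (var_gates C (x a) \<union> var_gates C (x b))"
    proof (rule card_independent_outputs_le[OF C])
      show "\<exists>v. gate_computes C v (mat_vars M x i)" if "i \<in> {0..<n}" for i
        using comp that unfolding computes_family_def by auto
      show "mat_vars M x i {#x a#} \<otimes> mat_vars M x j {#x b#}
          \<noteq> mat_vars M x i {#x b#} \<otimes> mat_vars M x j {#x a#}"
        if "i \<in> {0..<n}" "j \<in> {0..<n}" "i \<noteq> j" for i j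
        using totally_regular_minor_2[OF M, of i j a b] that ab by (simp add: coeff)
    qed (use n in auto)
    also have "\<dots> \<le> 2 * (?l a + ?l b)"
      using card_Un_le[of "var_gates C (x a)" "var_gates C (x b)"] by simp
    finally show ?thesis by simp
  qed
  let ?few = "{a \<in> {0..<n}. 4 * ?l a < n}"
  \<comment> \<open>Two such variables would together label fewer than \<open>n / 2\<close> gates,
    against \<open>pair\<close>.\<close>
  have "a = b" if "a \<in> ?few" "b \<in> ?few" for a b
  proof (rule ccontr)
    assume "a \<noteq> b"
    then show False
      using that pair[of a b] pair[of b a] by (cases "a < b") auto
  qed
  then have "card ?few \<le> 1"
    using card_le_Suc0_iff_eq[of ?few] by simp
  moreover have "card ({0..<n} - ?few) = n - card ?few"
    by (subst card_Diff_subset) auto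
  ultimately have "n - 1 \<le> card ({0..<n} - ?few)"
    by linarith
  then have "n * (n - 1) \<le> n * card ({0..<n} - ?few)"
    by (rule mult_le_mono2)
  also have "\<dots> = (\<Sum>a\<in>{0..<n} - ?few. n)"
    by (simp only: sum_constant mult.commute of_nat_id)
  also have "\<dots> \<le> (\<Sum>a\<in>{0..<n} - ?few. 4 * ?l a)"
    by (intro sum_mono) auto
  also have "\<dots> \<le> (\<Sum>a\<in>{0..<n}. 4 * ?l a)"
    by (intro sum_mono2) auto
  \<comment> \<open>A gate carries one label and \<open>x\<close> is injective, so no gate is
    counted for two variables.\<close>
  also have "\<dots> = 4 * card (\<Union>a\<in>{0..<n}. var_gates C (x a))"
    using fin x by (subst card_UN_disjoint)
      (auto simp: sum_distrib_left var_gates_def inj_on_eq_iff)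
  also have "\<dots> \<le> 4 * circuit_size C"
    unfolding circuit_size_def by (intro mult_left_mono card_mono) (auto simp: var_gates_def)
  finally show ?thesis .
qed

end

theorem theorem1p7:
  shows "\<exists>c::real. c > 0 \<and>
    (\<forall>\<^sub>F n in sequentially.
       \<forall>(F :: 'a ring) (M :: 'a mat) (x :: nat \<Rightarrow> 'v) (C :: ('a, 'v, 'g, 'w) circuit).
         field F \<longrightarrow>
         M \<in> carrier_mat n n \<longrightarrow> elements_mat M \<subseteq> carrier F \<longrightarrow>
         ring.totally_regular F M \<longrightarrow>
         inj_on x {0..<n} \<longrightarrow>
         ring.multi_output_formula F C \<longrightarrow>
         ring.computes_family F C n (ring.mat_vars F M x) \<longrightarrow>
         real (circuit_size C) \<ge> c * (real n ^ 2 / ln (real n)))"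
proof (intro exI[of _ "1 / 8 :: real"] conjI eventually_sequentiallyI[of 3] allI impI)
  fix n :: nat and F :: "'a ring" and M :: "'a mat" and x :: "nat \<Rightarrow> 'v"
    and C :: "('a, 'v, 'g, 'w) circuit"
  assume n: "3 \<le> n" and F: "field F"
    and M: "M \<in> carrier_mat n n" "elements_mat M \<subseteq> carrier F" "ring.totally_regular F M"
    and x: "inj_on x {0..<n}" and C: "ring.multi_output_formula F C"
    and comp: "ring.computes_family F C n (ring.mat_vars F M x)"
  interpret field F by (rule F)
  have "n * (n - 1) \<le> 4 * circuit_size C"
    using circuit_size_ge_quadratic[OF M x C comp] n by simp
  then have "real n * real (n - 1) \<le> 4 * real (circuit_size C)"
    by (metis of_nat_le_iff of_nat_mult of_nat_numeral)
  \<comment> \<open>Replacing \<open>n - 1\<close> by \<open>n / 2\<close> turns the factor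
    \<open>1 / 4\<close> into the constant \<open>1 / 8\<close>.\<close>
  moreover have "real n * (real n / 2) \<le> real n * real (n - 1)"
    using n by (intro mult_left_mono) auto
  ultimately have size: "real n ^ 2 / 8 \<le> real (circuit_size C)"
    by (simp add: power2_eq_square)
  \<comment> \<open>The threshold 3 lies above \<open>exp 1\<close>, so the logarithm is at least 1
    and dividing by it only weakens the quadratic bound.\<close>
  have "exp 1 \<le> real n"
    using exp_le n by linarith
  then have "1 \<le> ln (real n)"
    using n by (subst ln_ge_iff) auto
  then have "real n ^ 2 / ln (real n) \<le> real n ^ 2 / 1"
    by (intro divide_left_mono) auto
  with size show "1 / 8 * (real n ^ 2 / ln (real n)) \<le> real (circuit_size C)"
    by simp
qed simp

end
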